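(* Let $f\in P_2^n$ be a Boolean function. Then $imp(f)=1$ if $ess(f)=0$; $imp(f)=2$ if $ess(f)=1$; and $imp(f)=\sum_{x\in Ess(f)}\big[imp(f(x=0))+imp(f(x=1))\big]$ if $ess(f)\ge2$.
   Context: $P_2^n$ is the set of functions $\{0,1\}^n\to\{0,1\}$ in variables $x_1,\dots,x_n$. $x_i$ is essential in $f$ if changing only the value of $x_i$ can change the value of $f$; $Ess(f)$ is the set of essential variables, $ess(f)=|Ess(f)|$; $f(x=c)$ is the function obtained by substituting the constant $c$ for $x$. Given a linear ordering of the variables, the ordered decomposition tree of $f$ is the complete binary tree whose internal nodes at depth $d$ are labelled by the $d$-th variable, with the two outgoing edges of each internal node labelled $0$ and $1$ and leaves labelled by the value of $f$ at the assignment along the path; a function node sits above the root with one edge to it. The ordered (binary) decision diagram for that ordering is obtained from the tree by repeatedly merging terminal nodes with equal labels and non-terminal nodes with equal labels and equal children, and removing non-terminal nodes both of whose children are identical (redirecting incoming edges to that child), until neither rule applies. An implementation of $f$ is a path in some such diagram of $f$ (for some variable ordering) from the function node to a terminal node, recorded as the pair of words $(i_1\dots i_r,\ c_1\dots c_rc)$, where $x_{i_1},\dots,x_{i_r}$ are the labels of its non-terminal nodes in order, $c_1,\dots,c_r$ the labels of the edges taken from them, and $c$ the label of the terminal node. $Imp(f)$ is the set of all such pairs over all diagrams of $f$ (identical pairs arising from different orderings counted once), and $imp(f)=|Imp(f)|$. *)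

theory Defs
  imports "HOL-Library.FuncSet"
begin

text \<open>
  The truth values 0 and 1 are \<^term>\<open>False\<close> and \<^term>\<open>True\<close>, and the variable
  \<open>x_i\<close> is its index \<open>i \<in> {1..n}\<close>.
\<close>

definition cube :: "nat \<Rightarrow> (nat \<Rightarrow> bool) set" where
  "cube n = {1..n} \<rightarrow>\<^sub>E UNIV"

definition P2 :: "nat \<Rightarrow> ((nat \<Rightarrow> bool) \<Rightarrow> bool) set" where
  "P2 n = cube n \<rightarrow>\<^sub>E UNIV"

definition Ess :: "nat \<Rightarrow> ((nat \<Rightarrow> bool) \<Rightarrow> bool) \<Rightarrow> nat set" where
  "Ess n f = {i \<in> {1..n}. \<exists>a \<in> cube n. \<exists>b. f (a(i := b)) \<noteq> f a}"

definition ess :: "nat \<Rightarrow> ((nat \<Rightarrow> bool) \<Rightarrow> bool) \<Rightarrow> nat" where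
  "ess n f = card (Ess n f)"

text \<open>
  The function \<open>f(x_i = c)\<close> is kept as a member of \<open>P2 n\<close>, in which \<open>x_i\<close> is not essential,
  so that the remaining variables keep their indices.
\<close>

definition subst_const ::
  "nat \<Rightarrow> ((nat \<Rightarrow> bool) \<Rightarrow> bool) \<Rightarrow> nat \<Rightarrow> bool \<Rightarrow> (nat \<Rightarrow> bool) \<Rightarrow> bool" where
  "subst_const n f i c = (\<lambda>a \<in> cube n. f (a(i := c)))"


section \<open>Decision diagrams\<close>

text \<open>
  \<open>Branch i u v\<close> is a non-terminal node labelled \<open>x_i\<close> whose edge labelled 0 leads to \<open>u\<close> and
  whose edge labelled 1 leads to \<open>v\<close>.  The function node of a diagram is represented by
  the target \<open>entry\<close> of its only edge; all other nodes are the elements of the domain of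
  \<open>node_at\<close>.
\<close>

datatype 'v node = Terminal bool | Branch nat 'v 'v

record 'v diagram =
  entry :: 'v
  node_at :: "'v \<Rightarrow> 'v node option"

definition var_order :: "nat \<Rightarrow> nat list \<Rightarrow> bool" where
  "var_order n xs \<longleftrightarrow> distinct xs \<and> set xs = {1..n}"

text \<open>
  The nodes of the tree are the words over \<open>{0,1}\<close> of length at most \<open>n\<close>: the word \<open>w\<close> is the
  node reached from the root by following the edges labelled by the letters of \<open>w\<close>.
\<close>

definition decomp_tree ::
  "nat \<Rightarrow> ((nat \<Rightarrow> bool) \<Rightarrow> bool) \<Rightarrow> nat list \<Rightarrow> bool list diagram" where
  "decomp_tree n f xs =
    \<lparr> entry = [],
      node_at = (\<lambda>w.
        if length w < n then Some (Branch (xs ! length w) (w @ [False]) (w @ [True]))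
        else if length w = n then Some (Terminal (f (\<lambda>i \<in> {1..n}. the (map_of (zip xs w) i))))
        else None) \<rparr>"

text \<open>Delete the node \<open>u\<close>, redirecting all edges into \<open>u\<close> to \<open>v\<close>.\<close>

definition redirect :: "'v \<Rightarrow> 'v \<Rightarrow> 'v diagram \<Rightarrow> 'v diagram" where
  "redirect u v D =
    \<lparr> entry = (id(u := v)) (entry D),
      node_at = (\<lambda>w. if w = u then None else map_option (map_node (id(u := v))) (node_at D w)) \<rparr>"

inductive reduces :: "'v diagram \<Rightarrow> 'v diagram \<Rightarrow> bool" where
  merge_terminal:
    "\<lbrakk> u \<noteq> v; node_at D u = Some (Terminal c); node_at D v = Some (Terminal c) \<rbrakk>
      \<Longrightarrow> reduces D (redirect u v D)"
| merge_branch: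
    "\<lbrakk> u \<noteq> v; node_at D u = Some (Branch i s t); node_at D v = Some (Branch i s t) \<rbrakk>
      \<Longrightarrow> reduces D (redirect u v D)"
| remove_redundant:
    "node_at D u = Some (Branch i s s) \<Longrightarrow> reduces D (redirect u s D)"

definition is_decision_diagram ::
  "nat \<Rightarrow> ((nat \<Rightarrow> bool) \<Rightarrow> bool) \<Rightarrow> nat list \<Rightarrow> bool list diagram \<Rightarrow> bool" where
  "is_decision_diagram n f xs D \<longleftrightarrow>
    reduces\<^sup>*\<^sup>* (decomp_tree n f xs) D \<and> (\<nexists>D'. reduces D D')"


section \<open>Implementations\<close>

text \<open>
  \<open>path_word D u is cs\<close>: some path of \<open>D\<close> from the node \<open>u\<close> to a terminal node has the variable
  labels \<open>is\<close>, and \<open>cs\<close> consists of its edge labels followed by its terminal label.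
\<close>

inductive path_word :: "'v diagram \<Rightarrow> 'v \<Rightarrow> nat list \<Rightarrow> bool list \<Rightarrow> bool" for D where
  terminal: "node_at D u = Some (Terminal c) \<Longrightarrow> path_word D u [] [c]"
| branch: "\<lbrakk> node_at D u = Some (Branch i s t); path_word D (if c then t else s) is cs \<rbrakk>
    \<Longrightarrow> path_word D u (i # is) (c # cs)"

definition Imp :: "nat \<Rightarrow> ((nat \<Rightarrow> bool) \<Rightarrow> bool) \<Rightarrow> (nat list \<times> bool list) set" where
  "Imp n f = {(is, cs). \<exists>xs D. var_order n xs \<and> is_decision_diagram n f xs D
    \<and> path_word D (entry D) is cs}"

definition imp :: "nat \<Rightarrow> ((nat \<Rightarrow> bool) \<Rightarrow> bool) \<Rightarrow> nat" where
  "imp n f = card (Imp n f)"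

end

theory Submission imports Defs begin

text \<open>
  Every node of a diagram computes a subfunction of \<open>f\<close>, and this survives the reductions. In an
  irreducible diagram distinct nodes compute distinct functions, so every branching node tests an
  essential variable of its function, and any essential variable that comes first in the ordering
  is tested. Hence, over all orderings, the implementations of \<open>f\<close> are obtained by freely
  choosing an essential variable and a value for it and continuing with the restricted function
  until it is constant. Splitting off the first choice gives the recursion.
\<close>

inductive impl ::
  "nat \<Rightarrow> ((nat \<Rightarrow> bool) \<Rightarrow> bool) \<Rightarrow> nat list \<Rightarrow> bool list \<Rightarrow> bool" for n where
  const: "impl n (\<lambda>a \<in> cube n. c) [] [c]"
| choose: "\<lbrakk> i \<in> Ess n f; impl n (subst_const n f i c) is cs \<rbrakk> \<Longrightarrow> impl n f (i # is) (c # cs)"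


section \<open>Essential variables\<close>

lemma cube_upd: "a \<in> cube n \<Longrightarrow> i \<in> {1..n} \<Longrightarrow> a(i := b) \<in> cube n"
  unfolding cube_def by (auto simp: PiE_iff extensional_def)

lemma cube_nonempty: "\<exists>a. a \<in> cube n"
proof
  show "(\<lambda>i \<in> {1..n}. False) \<in> cube n" by (simp add: cube_def)
qed

lemma P2_eqI:
  assumes "f \<in> P2 n" "g \<in> P2 n" "\<And>a. a \<in> cube n \<Longrightarrow> f a = g a"
  shows "f = g"
  using assms unfolding P2_def by (auto intro: PiE_ext)

lemma subst_const_P2: "subst_const n f i c \<in> P2 n"
  by (simp add: P2_def subst_const_def)

lemma finite_Ess: "finite (Ess n f)"
  by (simp add: Ess_def)

lemma Ess_const: "Ess n (\<lambda>a \<in> cube n. c) = {}"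
  using cube_upd by (fastforce simp: Ess_def)

lemma const_eq_iff: "(\<lambda>a \<in> cube n. c) = (\<lambda>a \<in> cube n. d) \<longleftrightarrow> c = d"
  using cube_nonempty by (metis restrict_apply')

lemma EssI: "i \<in> {1..n} \<Longrightarrow> a \<in> cube n \<Longrightarrow> f (a(i := b)) \<noteq> f a \<Longrightarrow> i \<in> Ess n f"
  unfolding Ess_def by blast

lemma not_essD: "j \<notin> Ess n f \<Longrightarrow> j \<in> {1..n} \<Longrightarrow> a \<in> cube n \<Longrightarrow> f (a(j := b)) = f a"
  by (auto simp: Ess_def)

lemma subst_const_not_ess:
  assumes "f \<in> P2 n" "j \<in> {1..n}" "j \<notin> Ess n f"
  shows "subst_const n f j c = f"
  using assms by (intro P2_eqI[OF subst_const_P2]) (auto simp: subst_const_def not_essD)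

text \<open>If \<open>x_j\<close> matters after the substitution, it matters to \<open>f\<close> at
  a point with \<open>x_i = c\<close>; and \<open>j\<close> is not \<open>i\<close>, since the
  substitution overwrites that coordinate.\<close>

lemma Ess_subst_const:
  assumes "i \<in> {1..n}"
  shows "Ess n (subst_const n f i c) \<subseteq> Ess n f - {i}"
proof
  fix j assume "j \<in> Ess n (subst_const n f i c)"
  then obtain a b where j: "j \<in> {1..n}" and a: "a \<in> cube n"
    and "subst_const n f i c (a(j := b)) \<noteq> subst_const n f i c a"
    unfolding Ess_def by blast
  then have ne: "f (a(j := b, i := c)) \<noteq> f (a(i := c))"
    by (simp add: subst_const_def cube_upd)
  then have "j \<noteq> i" by auto
  then have "f ((a(i := c))(j := b)) \<noteq> f (a(i := c))"
    using ne by (simp add: fun_upd_twist)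
  then show "j \<in> Ess n f - {i}"
    using j \<open>j \<noteq> i\<close> cube_upd[OF a assms] by (auto simp: Ess_def)
qed

lemma Ess_subset: "Ess n f \<subseteq> {1..n}"
  by (auto simp: Ess_def)

text \<open>Two points differing in finitely many coordinates are joined by changing one coordinate
  at a time, and no such change alters the value when no variable is essential.\<close>

lemma Ess_empty_const:
  assumes "f \<in> P2 n" "Ess n f = {}"
  shows "\<exists>c. f = (\<lambda>a \<in> cube n. c)"
proof -
  have agree: "f a = f b"
    if "finite S" "S \<subseteq> {1..n}" "a \<in> cube n" "b \<in> cube n" "\<And>i. i \<notin> S \<Longrightarrow> a i = b i" for S a b
    using that
  proof (induction S arbitrary: a rule: finite_induct)
    case empty
    then have "a = b" by (intro ext) simp
    then show ?case by simp
  next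
    case (insert i S)
    have "f (a(i := b i)) = f b"
    proof (rule insert.IH)
      show "a(i := b i) \<in> cube n" using insert.prems by (intro cube_upd) auto
    qed (use insert.prems in auto)
    then show ?case
      using not_essD[of i n f a "b i"] insert.prems assms(2) by simp
  qed
  \<comment> \<open>Points of the cube are all \<open>undefined\<close> outside
    \<open>{1..n}\<close>, so they can differ only on that finite set.\<close>
  have const: "f a = f b" if "a \<in> cube n" "b \<in> cube n" for a b
  proof (rule agree[of "{1..n}"])
    show "a i = b i" if "i \<notin> {1..n}" for i
      using that \<open>a \<in> cube n\<close> \<open>b \<in> cube n\<close> by (metis PiE_arb cube_def)
  qed (use that in auto)
  obtain b where b: "b \<in> cube n" using cube_nonempty by blast
  have "f = (\<lambda>a \<in> cube n. f b)"
  proof (rule P2_eqI[OF assms(1)])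
    show "f a = (\<lambda>a \<in> cube n. f b) a" if "a \<in> cube n" for a
      using const[OF that b] that by simp
  qed (simp add: P2_def)
  then show ?thesis ..
qed


section \<open>Diagrams whose nodes compute functions\<close>

text \<open>
  Edges are only ever redirected to a node with the same function and no smaller level, so
  \<open>sem\<close> and \<open>lev\<close>, once chosen for the decomposition tree, serve every diagram obtained from it.
\<close>

locale ordered_diagram =
  fixes n :: nat and xs :: "nat list" and f :: "(nat \<Rightarrow> bool) \<Rightarrow> bool"
    and sem :: "'v \<Rightarrow> (nat \<Rightarrow> bool) \<Rightarrow> bool" and lev :: "'v \<Rightarrow> nat" and D :: "'v diagram"
  assumes var_order: "var_order n xs"
    and entry: "entry D \<in> dom (node_at D)" "sem (entry D) = f"
    and sem_P2: "u \<in> dom (node_at D) \<Longrightarrow> sem u \<in> P2 n"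
    and terminal: "node_at D u = Some (Terminal b) \<Longrightarrow> sem u = (\<lambda>a \<in> cube n. b) \<and> lev u = n"
    and branch_label: "node_at D u = Some (Branch i s t) \<Longrightarrow> lev u < n \<and> i = xs ! lev u"
    and branch_child: "node_at D u = Some (Branch i s t) \<Longrightarrow>
      (if c then t else s) \<in> dom (node_at D) \<and> lev u < lev (if c then t else s)"
    and branch_sem: "node_at D u = Some (Branch i s t) \<Longrightarrow> a \<in> cube n \<Longrightarrow>
      sem u a = sem (if a i then t else s) a"
begin

lemma length_order: "length xs = n" and distinct_order: "distinct xs"
  and set_order: "set xs = {1..n}"
  using var_order distinct_card[of xs] by (auto simp: var_order_def)

lemma label_range:
  assumes "node_at D u = Some (Branch i s t)"
  shows "i \<in> {1..n}"
  using branch_label[OF assms] nth_mem[of "lev u" xs] by (simp add: length_order set_order)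

text \<open>Induction down the levels: a change of a variable other than the label keeps the
  evaluation in the same child, so if it matters at \<open>u\<close>, the variable is essential in
  that child.\<close>

lemma Ess_sem:
  assumes "u \<in> dom (node_at D)" "i \<in> Ess n (sem u)"
  shows "\<exists>k. lev u \<le> k \<and> k < n \<and> i = xs ! k"
  using assms
proof (induction "n - lev u" arbitrary: u rule: less_induct)
  case less
  then obtain nd where nd: "node_at D u = Some nd" by auto
  show ?case
  proof (cases nd)
    case (Terminal c)
    then show ?thesis using terminal[of u c] nd less.prems Ess_const by simp
  next
    case (Branch j s t)
    then have u: "node_at D u = Some (Branch j s t)" using nd by simp
    show ?thesis
    proof (cases "i = j")
      case True
      then show ?thesis using branch_label[OF u] by blast
    next
      case False
      obtain a b where i: "i \<in> {1..n}" and a: "a \<in> cube n" and ne: "sem u (a(i := b)) \<noteq> sem u a"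
        using less.prems(2) unfolding Ess_def by blast
      let ?v = "if a j then t else s"
      have "sem ?v (a(i := b)) \<noteq> sem ?v a"
        using ne branch_sem[OF u a] branch_sem[OF u cube_upd[OF a i], of b] False by simp
      then have "i \<in> Ess n (sem ?v)" using EssI[OF i a] by blast
      moreover note v = branch_child[OF u, of "a j"]
      ultimately have "\<exists>k. lev ?v \<le> k \<and> k < n \<and> i = xs ! k"
        using branch_label[OF u] by (intro less.hyps) auto
      then show ?thesis using v less_imp_le le_trans by blast
    qed
  qed
qed

text \<open>\<open>branch_sem\<close> relates \<open>u\<close> to this child only at points with
  \<open>a i = c\<close>. The child lies at a deeper level, so by \<open>Ess_sem\<close> its
  function ignores \<open>x_i\<close>, and the relation extends to all points.\<close>

lemma sem_child:
  assumes u: "node_at D u = Some (Branch i s t)"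
  shows "sem (if c then t else s) = subst_const n (sem u) i c"
proof (rule P2_eqI[OF sem_P2 subst_const_P2])
  let ?v = "if c then t else s"
  show v: "?v \<in> dom (node_at D)" using branch_child[OF u] by blast
  have i: "i \<in> {1..n}" using label_range[OF u] .
  have "i \<notin> Ess n (sem ?v)"
  proof
    assume "i \<in> Ess n (sem ?v)"
    then obtain k where "lev ?v \<le> k" "k < n" "i = xs ! k" using Ess_sem[OF v] by blast
    then show False
      using branch_label[OF u] branch_child[OF u, of c] nth_eq_iff_index_eq[OF distinct_order]
        length_order by (metis leD)
  qed
  then show "sem ?v a = subst_const n (sem u) i c a" if "a \<in> cube n" for a
    using branch_sem[OF u cube_upd[OF that i], of c] not_essD[of i n "sem ?v" a c] i that
    by (simp add: subst_const_def)
qed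

text \<open>Serves all three reduction rules: a redirected edge leads to a node with the same
  function, at least as deep, so children stay strictly below their parents.\<close>

lemma redirect:
  assumes u: "u \<in> dom (node_at D)" and v: "v \<in> dom (node_at D)" and "u \<noteq> v"
    and sem: "sem u = sem v" and lev: "lev u \<le> lev v"
  shows "ordered_diagram n xs f sem lev (redirect u v D)"
proof
  let ?r = "id(u := v)"
  have dom: "dom (node_at (redirect u v D)) = dom (node_at D) - {u}"
    by (auto simp: redirect_def split: if_splits)
  have r: "?r w \<in> dom (node_at D) - {u}" if "w \<in> dom (node_at D)" for w
    using that v \<open>u \<noteq> v\<close> by auto
  have sem_r: "sem (?r w) = sem w" and lev_r: "lev w \<le> lev (?r w)" for w
    using sem lev by auto
  show "entry (redirect u v D) \<in> dom (node_at (redirect u v D))"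
    unfolding dom using r[OF entry(1)] by (simp add: redirect_def)
  show "sem (entry (redirect u v D)) = f"
    using sem_r entry(2) by (simp add: redirect_def)
  fix w
  show "sem w \<in> P2 n" if "w \<in> dom (node_at (redirect u v D))"
    using that sem_P2 unfolding dom by blast
  show "sem w = (\<lambda>a \<in> cube n. b) \<and> lev w = n"
    if "node_at (redirect u v D) w = Some (Terminal b)" for b
  proof -
    from that obtain nd where "node_at D w = Some nd" "map_node ?r nd = Terminal b"
      by (auto simp: redirect_def split: if_splits)
    then show ?thesis using terminal by (cases nd) auto
  qed
  fix i s t
  assume "node_at (redirect u v D) w = Some (Branch i s t)"
  then obtain nd where "node_at D w = Some nd" "map_node ?r nd = Branch i s t"
    by (auto simp: redirect_def split: if_splits)
  then obtain s' t' where w: "node_at D w = Some (Branch i s' t')" and st: "s = ?r s'" "t = ?r t'"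
    by (cases nd) auto
  have child: "(if c then t else s) = ?r (if c then t' else s')" for c
    using st by simp
  show "lev w < n \<and> i = xs ! lev w" using branch_label[OF w] .
  show "(if c then t else s) \<in> dom (node_at (redirect u v D)) \<and> lev w < lev (if c then t else s)"
    for c
    unfolding dom child
    using branch_child[OF w, of c] r lev_r[of "if c then t' else s'"] less_le_trans by blast
  show "sem w a = sem (if a i then t else s) a" if "a \<in> cube n" for a
    unfolding child sem_r by (rule branch_sem[OF w that])
qed (rule var_order)

lemma reduces:
  assumes "reduces D D'"
  shows "ordered_diagram n xs f sem lev D'"
  using assms
proof cases
  case (merge_terminal u v c)
  then have "sem u = sem v" "lev u = lev v"
    using terminal[of u c] terminal[of v c] by simp_all
  then show ?thesis
    using merge_terminal by (auto intro: redirect)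
next
  case (merge_branch u v i s t)
  note u = merge_branch(3) and v = merge_branch(4)
  have "sem u = sem v"
    using u v by (intro P2_eqI[OF sem_P2 sem_P2]) (auto simp only: branch_sem domIff)
  \<comment> \<open>Equal labels force equal levels, because the ordering has no
    repetitions.\<close>
  moreover have "lev u = lev v"
    using branch_label[OF u] branch_label[OF v] nth_eq_iff_index_eq[OF distinct_order] length_order
    by metis
  ultimately show ?thesis
    using merge_branch by (auto intro: redirect)
next
  case (remove_redundant u i s)
  note u = remove_redundant(2)
  have s: "s \<in> dom (node_at D)" "lev u < lev s"
    using branch_child[OF u, of True] by auto
  then have "sem u = sem s"
    using u branch_sem[OF u] by (intro P2_eqI[OF sem_P2 sem_P2]) auto
  then show ?thesis
    using remove_redundant s by (auto intro!: redirect)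
qed

end

lemma reduces_rtranclp_ordered:
  assumes "reduces\<^sup>*\<^sup>* D D'" "ordered_diagram n xs f sem lev D"
  shows "ordered_diagram n xs f sem lev D'"
  using assms by (induction rule: rtranclp_induct) (auto intro: ordered_diagram.reduces)


section \<open>Irreducible diagrams\<close>

locale irreducible_diagram = ordered_diagram +
  assumes irreducible: "\<nexists>D'. reduces D D'"
begin

text \<open>Induction upwards from the terminal level. A branching node tests an essential variable,
  so it cannot share its function with a terminal. Two branching nodes with the same function have
  equal labels, and their children compute the same restrictions and coincide by induction, so if
  distinct they could still be merged.\<close>

lemma sem_inj:
  assumes "u \<in> dom (node_at D)" "v \<in> dom (node_at D)" "sem u = sem v"
  shows "u = v"
proof -
  \<comment> \<open>The parameter \<open>k\<close> bounds how far both levels are from the terminal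
    level \<open>n\<close>.\<close>
  have "u = v"
    if "u \<in> dom (node_at D)" "v \<in> dom (node_at D)" "sem u = sem v" "n \<le> lev u + k" "n \<le> lev v + k"
    for u v k
    using that
  proof (induction k arbitrary: u v rule: less_induct)
    case (less k)
    \<comment> \<open>Nodes strictly below \<open>w\<close> satisfy the bound \<open>k - 1\<close>;
      here \<open>k\<close> is positive because \<open>lev w < n\<close>.\<close>
    have IH: "s = t" if "s \<in> dom (node_at D)" "t \<in> dom (node_at D)" "sem s = sem t"
      "n \<le> lev w + k" "lev w < n" "lev w < lev s" "lev w < lev t" for s t w
      using that by (intro less.IH[of "k - 1"]) auto
    \<comment> \<open>Otherwise both children compute \<open>sem w\<close>, hence coincide by
      induction, and \<open>w\<close> could be removed.\<close>
    have label_ess: "i \<in> Ess n (sem w)"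
      if w: "node_at D w = Some (Branch i s t)" and k: "n \<le> lev w + k" for w i s t
    proof (rule ccontr)
      assume "i \<notin> Ess n (sem w)"
      moreover have "sem w \<in> P2 n" using w by (intro sem_P2) auto
      ultimately have "subst_const n (sem w) i c = sem w" for c
        using subst_const_not_ess label_range[OF w] by blast
      then have "sem s = sem t"
        using sem_child[OF w, of True] sem_child[OF w, of False] by simp
      then have "s = t"
        using IH[of s t w] branch_child[OF w, of True] branch_child[OF w, of False]
          branch_label[OF w] k by simp
      then show False using w irreducible reduces.remove_redundant[of D w i s] by auto
    qed
    obtain x y where x: "node_at D u = Some x" and y: "node_at D v = Some y"
      using less.prems by auto
    show ?case
    proof (cases x; cases y)
      fix c d assume "x = Terminal c" "y = Terminal d"
      then have u: "node_at D u = Some (Terminal c)" and v: "node_at D v = Some (Terminal d)"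
        using x y by auto
      then have "c = d" using terminal less.prems(3) const_eq_iff by metis
      then show ?thesis using u v irreducible reduces.merge_terminal[of u v D c] by auto
    next
      fix c j s t assume "x = Terminal c" "y = Branch j s t"
      then show ?thesis
        using x y terminal[of u c] label_ess[of v j s t] less.prems Ess_const by (metis empty_iff)
    next
      fix c j s t assume "x = Branch j s t" "y = Terminal c"
      then show ?thesis
        using x y terminal[of v c] label_ess[of u j s t] less.prems Ess_const by (metis empty_iff)
    next
      fix i s t j s' t' assume "x = Branch i s t" "y = Branch j s' t'"
      then have u: "node_at D u = Some (Branch i s t)" and v: "node_at D v = Some (Branch j s' t')"
        using x y by auto
      \<comment> \<open>The label of \<open>a\<close> is essential for \<open>b\<close> too, so its
        only position \<open>lev a\<close> in the ordering is at least \<open>lev b\<close>. Used in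
        both directions.\<close>
      have pos: "lev b \<le> lev a"
        if a: "node_at D a = Some (Branch i s t)" and b: "b \<in> dom (node_at D)"
          and ab: "sem a = sem b" "n \<le> lev a + k" for a b i s t
      proof -
        obtain m where "lev b \<le> m" "m < n" "i = xs ! m"
          using Ess_sem[OF b, of i] label_ess[OF a ab(2)] ab(1) by auto
        then show ?thesis
          using branch_label[OF a] nth_eq_iff_index_eq[OF distinct_order] length_order by metis
      qed
      have "lev u = lev v"
        using pos[OF u, of v] pos[OF v, of u] less.prems by simp
      then have ij: "i = j" using branch_label[OF u] branch_label[OF v] by simp
      have "(if c then t else s) = (if c then t' else s')" for c
        using branch_child[OF u, of c] branch_child[OF v, of c] sem_child[OF u, of c]
          sem_child[OF v, of c] \<open>lev u = lev v\<close> ij less.prems branch_label[OF u]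
        by (intro IH[of _ _ u]) auto
      from this[of True] this[of False] have "t = t'" "s = s'" by auto
      then show ?thesis
        using u v ij irreducible reduces.merge_branch[of u v D i s t] by auto
    qed
  qed
  from this[of u v n] assms show ?thesis by simp
qed

text \<open>The argument inside \<open>sem_inj\<close>, now without the level bound since
  injectivity holds for all nodes.\<close>

lemma label_ess:
  assumes u: "node_at D u = Some (Branch i s t)"
  shows "i \<in> Ess n (sem u)"
proof (rule ccontr)
  assume "i \<notin> Ess n (sem u)"
  moreover have "sem u \<in> P2 n" using u by (intro sem_P2) auto
  ultimately have "subst_const n (sem u) i c = sem u" for c
    using subst_const_not_ess label_range[OF u] by blast
  then have "s = t"
    using sem_child[OF u, of True] sem_child[OF u, of False]
      branch_child[OF u, of True] branch_child[OF u, of False] by (intro sem_inj) auto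
  then show False using u irreducible reduces.remove_redundant[of D u i s] by auto
qed

lemma path_word_impl:
  assumes "path_word D u is cs"
  shows "impl n (sem u) is cs"
  using assms
proof induction
  case (terminal u c)
  then have "sem u = (\<lambda>a \<in> cube n. c)"
    using ordered_diagram.terminal[OF ordered_diagram_axioms] by blast
  then show ?case using impl.const by metis
next
  case (branch u i s t c "is" cs)
  then show ?case using sem_child[OF branch(1), of c] label_ess[OF branch(1)]
    by (simp add: impl.choose)
qed

text \<open>\<open>ps\<close> is the part of the ordering already passed. The label of
  \<open>u\<close> is essential, so \<open>u\<close> has level at least \<open>length ps\<close>.
  The chosen variable stands at position \<open>length ps\<close> and is essential, so by
  \<open>Ess_sem\<close> the level is no larger. Hence \<open>u\<close> tests exactly the chosen
  variable.\<close>

lemma impl_path_word: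
  assumes "impl n (sem u) is cs" "u \<in> dom (node_at D)"
    and "xs = ps @ is @ qs" "set ps \<inter> Ess n (sem u) = {}"
  shows "path_word D u is cs"
  using assms
proof (induction "sem u" "is" cs arbitrary: u ps)
  case (const c)
  then obtain nd where nd: "node_at D u = Some nd" by auto
  show ?case
  proof (cases nd)
    case (Terminal d)
    then have "c = d" using nd terminal[of u d] const(1) const_eq_iff by metis
    then show ?thesis using Terminal nd by (simp add: path_word.terminal)
  next
    case (Branch i s t)
    then show ?thesis using nd label_ess[of u i s t] const(1) Ess_const by (metis empty_iff)
  qed
next
  case (choose i c "is" cs)
  then obtain nd where nd: "node_at D u = Some nd" by auto
  show ?case
  proof (cases nd)
    case (Terminal d)
    then show ?thesis using nd terminal[of u d] choose.hyps(1) Ess_const by simp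
  next
    case (Branch j s t)
    then have u: "node_at D u = Some (Branch j s t)" using nd by simp
    have "j \<notin> set ps" using label_ess[OF u] choose.prems(3) by blast
    then have "length ps \<le> lev u"
      using branch_label[OF u] choose.prems(2) by (metis leI nth_append nth_mem)
    moreover obtain k where "lev u \<le> k" "k < n" "i = xs ! k"
      using Ess_sem[OF choose.prems(1) choose.hyps(1)] by blast
    moreover have "xs ! length ps = i" using choose.prems(2) by simp
    moreover have "length ps < n" using choose.prems(2) length_order by auto
    ultimately have "lev u = length ps"
      using nth_eq_iff_index_eq[OF distinct_order] length_order by (metis le_antisym)
    then have ij: "j = i" using branch_label[OF u] \<open>xs ! length ps = i\<close> by simp
    let ?v = "if c then t else s"
    have v: "subst_const n (sem u) i c = sem ?v"
      using sem_child[OF u, of c] ij by simp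
    have "path_word D ?v is cs"
    proof (rule choose.hyps(3)[OF v])
      show "?v \<in> dom (node_at D)" using branch_child[OF u] by blast
      show "xs = (ps @ [i]) @ is @ qs" using choose.prems(2) by simp
      \<comment> \<open>Once substituted, \<open>i\<close> is inessential and may join the passed
        prefix.\<close>
      show "set (ps @ [i]) \<inter> Ess n (sem ?v) = {}"
        using Ess_subst_const[of i n "sem u" c] label_range[OF u] ij choose.prems(3) v by auto
    qed
    then show ?thesis using u ij by (auto intro: path_word.branch)
  qed
qed

end


section \<open>Implementations as free choices of essential variables\<close>

text \<open>A word \<open>w\<close> fixes the first \<open>length w\<close> variables of the
  ordering; its node computes \<open>f\<close> with the remaining ones read off the
  argument.\<close>

lemma decomp_tree_ordered:
  assumes "f \<in> P2 n" "var_order n xs"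
  shows "ordered_diagram n xs f
    (\<lambda>w. \<lambda>a \<in> cube n. f (\<lambda>i \<in> {1..n}. the (map_of (zip xs (w @ map a (drop (length w) xs))) i)))
    length (decomp_tree n f xs)"
proof -
  have len: "length xs = n" and set: "set xs = {1..n}"
    using assms(2) distinct_card[of xs] by (auto simp: var_order_def)
  have id: "(\<lambda>i \<in> {1..n}. the (map_of (zip xs (map a xs)) i)) = a" if "a \<in> cube n" for a
  proof
    fix i show "(\<lambda>i \<in> {1..n}. the (map_of (zip xs (map a xs)) i)) i = a i"
      using that PiE_arb[of a "{1..n}" "\<lambda>_. UNIV" i]
      by (cases "i \<in> {1..n}") (simp_all add: map_of_zip_map set cube_def)
  qed
  show ?thesis
  proof
    show "(\<lambda>a \<in> cube n. f (\<lambda>i \<in> {1..n}. the (map_of (zip xs (entry (decomp_tree n f xs) @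
        map a (drop (length (entry (decomp_tree n f xs))) xs))) i))) = f"
      using assms(1) id
      by (intro P2_eqI[of _ n f]) (auto simp: decomp_tree_def P2_def)
  next
    fix w i s t a
    assume w: "node_at (decomp_tree n f xs) w = Some (Branch i s t)" and a: "a \<in> cube n"
    then have "length w < n" and i: "i = xs ! length w"
      and st: "s = w @ [False]" "t = w @ [True]"
      by (auto simp: decomp_tree_def split: if_splits)
    \<comment> \<open>The next variable to be read is \<open>i\<close>, so appending the letter
      \<open>a i\<close> to \<open>w\<close> yields the same assignment.\<close>
    then have "drop (length w) xs = i # drop (Suc (length w)) xs"
      using Cons_nth_drop_Suc[of "length w" xs] len by simp
    then show "(\<lambda>a \<in> cube n. f (\<lambda>i \<in> {1..n}.
          the (map_of (zip xs (w @ map a (drop (length w) xs))) i))) a =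
        (\<lambda>a' \<in> cube n. f (\<lambda>j \<in> {1..n}. the (map_of (zip xs ((if a i then t else s) @
          map a' (drop (length (if a i then t else s)) xs))) j))) a"
      using a st by simp
  qed (use assms len in \<open>auto simp: decomp_tree_def P2_def split: if_splits\<close>)
qed

lemma finite_dom_decomp_tree: "finite (dom (node_at (decomp_tree n f xs)))"
proof -
  have "dom (node_at (decomp_tree n f xs)) \<subseteq> {w. set w \<subseteq> UNIV \<and> length w \<le> n}"
    by (auto simp: decomp_tree_def split: if_splits)
  then show ?thesis by (rule finite_subset) (rule finite_lists_length_le[OF finite_UNIV])
qed

lemma reduces_dom:
  assumes "reduces D D'"
  shows "dom (node_at D') \<subset> dom (node_at D)"
  using assms by cases (auto simp: redirect_def split: if_splits)

text \<open>Every reduction deletes a node, so reducing a finite diagram terminates.\<close>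

lemma irreducible_exists:
  assumes "finite (dom (node_at D))"
  shows "\<exists>D'. reduces\<^sup>*\<^sup>* D D' \<and> (\<nexists>D''. reduces D' D'')"
  using assms
proof (induction "card (dom (node_at D))" arbitrary: D rule: less_induct)
  case less
  show ?case
  proof (cases "\<exists>D'. reduces D D'")
    case True
    then obtain D' where D': "reduces D D'" ..
    note sub = reduces_dom[OF D']
    obtain E where "reduces\<^sup>*\<^sup>* D' E" "\<nexists>D''. reduces E D''"
      using less.hyps[of D'] psubset_card_mono[OF less.prems sub]
        finite_subset[OF psubset_imp_subset[OF sub] less.prems] by auto
    then show ?thesis using converse_rtranclp_into_rtranclp[of reduces, OF D'] by blast
  qed blast
qed

lemma decision_diagram_irreducible:
  assumes "f \<in> P2 n" "var_order n xs" "is_decision_diagram n f xs D"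
  obtains sem lev where "irreducible_diagram n xs f sem lev D"
proof (rule that, intro irreducible_diagram.intro irreducible_diagram_axioms.intro)
  show "ordered_diagram n xs f
      (\<lambda>w. \<lambda>a \<in> cube n. f (\<lambda>i \<in> {1..n}. the (map_of (zip xs (w @ map a (drop (length w) xs))) i)))
      length D"
    using assms(3) reduces_rtranclp_ordered[OF _ decomp_tree_ordered[OF assms(1,2)]]
    unfolding is_decision_diagram_def by blast
  show "\<nexists>D'. reduces D D'" using assms(3) unfolding is_decision_diagram_def by blast
qed

text \<open>A substituted variable is no longer essential and cannot be chosen again. This allows
  \<open>is\<close> to be completed to an ordering.\<close>

lemma impl_distinct:
  assumes "impl n f is cs"
  shows "distinct is \<and> set is \<subseteq> Ess n f"
  using assms
proof induction
  case (choose i f c "is" cs)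
  then show ?case using Ess_subst_const[of i n f c] Ess_subset by fastforce
qed simp

text \<open>Eliminates the orderings: every path of a reduced diagram is a sequence of free choices,
  and such a sequence is a path for an ordering that begins with it.\<close>

lemma Imp_eq_impl:
  assumes f: "f \<in> P2 n"
  shows "Imp n f = {(is, cs). impl n f is cs}"
proof (intro set_eqI iffI; clarify)
  fix "is" cs assume "(is, cs) \<in> Imp n f"
  then obtain xs D where xs: "var_order n xs" and D: "is_decision_diagram n f xs D"
    and path: "path_word D (entry D) is cs"
    by (auto simp: Imp_def)
  obtain sem lev where "irreducible_diagram n xs f sem lev D"
    using decision_diagram_irreducible[OF f xs D] .
  then interpret irreducible_diagram n xs f sem lev D .
  show "impl n f is cs" using path_word_impl[OF path] entry(2) by simp
next
  fix "is" cs assume impl: "impl n f is cs"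
  \<comment> \<open>The variables not chosen may follow in any order; the increasing one is
    taken.\<close>
  let ?qs = "sorted_list_of_set ({1..n} - set is)"
  let ?xs = "is @ ?qs"
  have xs: "var_order n ?xs"
    using impl_distinct[OF impl] Ess_subset[of n f] by (auto simp: var_order_def)
  obtain D where D: "is_decision_diagram n f ?xs D"
    using irreducible_exists[OF finite_dom_decomp_tree] unfolding is_decision_diagram_def by blast
  obtain sem lev where "irreducible_diagram n ?xs f sem lev D"
    using decision_diagram_irreducible[OF f xs D] .
  then interpret irreducible_diagram n ?xs f sem lev D .
  have "path_word D (entry D) is cs"
    using impl_path_word[of "entry D" "is" cs "[]" ?qs] impl entry by simp
  then show "(is, cs) \<in> Imp n f" using xs D by (auto simp: Imp_def)
qed

section \<open>Recursion and counting of implementations\<close>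

lemma impl_const_iff: "impl n (\<lambda>a \<in> cube n. c) is cs \<longleftrightarrow> is = [] \<and> cs = [c]"
proof
  assume "impl n (\<lambda>a \<in> cube n. c) is cs"
  then show "is = [] \<and> cs = [c]"
  proof cases
    case (const d)
    have "c = d" using const(1) by (rule const_eq_iff[THEN iffD1])
    then show ?thesis using const by simp
  next
    case (choose i d is' cs')
    then show ?thesis by (simp only: Ess_const empty_iff)
  qed
qed (simp only: impl.const)

lemma Imp_const: "Imp n (\<lambda>a \<in> cube n. c) = {([], [c])}"
proof -
  have "(\<lambda>a \<in> cube n. c) \<in> P2 n" by (simp add: P2_def)
  from Imp_eq_impl[OF this] show ?thesis unfolding impl_const_iff by auto
qed

lemma imp_ess_0:
  assumes "f \<in> P2 n" "Ess n f = {}"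
  shows "imp n f = 1"
  using Ess_empty_const[OF assms] by (auto simp: imp_def Imp_const)

text \<open>With an essential variable \<open>f\<close> is not constant, so every derivation of
  \<open>impl\<close> ends with \<open>choose\<close>, and \<open>i\<close> and \<open>c\<close> are
  the first letters of the two words.\<close>

lemma Imp_rec:
  assumes "f \<in> P2 n" "Ess n f \<noteq> {}"
  shows "Imp n f = (\<Union>(i, c) \<in> Ess n f \<times> UNIV.
    map_prod ((#) i) ((#) c) ` Imp n (subst_const n f i c))"
proof -
  have "impl n f is cs \<longleftrightarrow> (\<exists>i c is' cs'. is = i # is' \<and> cs = c # cs' \<and> i \<in> Ess n f \<and>
      impl n (subst_const n f i c) is' cs')" for "is" cs
    using assms(2) Ess_const by (subst impl.simps) auto
  then show ?thesis
    unfolding Imp_eq_impl[OF assms(1)] Imp_eq_impl[OF subst_const_P2] by (auto simp: image_iff)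
qed

text \<open>Each substitution for an essential variable lowers the number of essential variables.
  Finiteness is what makes the cardinalities in \<open>imp_rec\<close> additive.\<close>

lemma finite_Imp: "f \<in> P2 n \<Longrightarrow> finite (Imp n f)"
proof (induction "card (Ess n f)" arbitrary: f rule: less_induct)
  case less
  show ?case
  proof (cases "Ess n f = {}")
    case True
    then show ?thesis using Ess_empty_const[OF less.prems] Imp_const by auto
  next
    case False
    have "finite (Imp n (subst_const n f i c))" if "i \<in> Ess n f" for i c
    proof (rule less.hyps[OF _ subst_const_P2])
      have "Ess n (subst_const n f i c) \<subset> Ess n f"
        using Ess_subst_const[of i n f c] Ess_subset that by blast
      then show "card (Ess n (subst_const n f i c)) < card (Ess n f)"
        using psubset_card_mono finite_Ess by blast
    qed
    then show ?thesis
      unfolding Imp_rec[OF less.prems False] using finite_Ess by auto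
  qed
qed

text \<open>The sets united in \<open>Imp_rec\<close> are disjoint, since the first letters reveal
  \<open>i\<close> and \<open>c\<close>, and prefixing letters is injective.\<close>

lemma imp_rec:
  assumes "f \<in> P2 n" "Ess n f \<noteq> {}"
  shows "imp n f =
    (\<Sum>i \<in> Ess n f. imp n (subst_const n f i False) + imp n (subst_const n f i True))"
proof -
  have inj: "inj_on (map_prod ((#) i) ((#) c)) A" for i :: nat and c :: bool and A
    by (auto simp: inj_on_def)
  have "imp n f = (\<Sum>(i, c) \<in> Ess n f \<times> UNIV.
      card (map_prod ((#) i) ((#) c) ` Imp n (subst_const n f i c)))"
    unfolding imp_def Imp_rec[OF assms]
    by (subst card_UN_disjoint)
      (auto simp: finite_Ess finite_Imp subst_const_P2 split_def)
  also have "\<dots> = (\<Sum>(i, c) \<in> Ess n f \<times> UNIV. imp n (subst_const n f i c))"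
    by (simp add: card_image[OF inj] imp_def)
  also have "\<dots> = (\<Sum>i \<in> Ess n f. \<Sum>c \<in> UNIV. imp n (subst_const n f i c))"
    by (simp add: sum.cartesian_product)
  finally show ?thesis by (simp add: UNIV_bool)
qed

theorem theorem5p1:
  fixes n :: nat and f :: "(nat \<Rightarrow> bool) \<Rightarrow> bool"
  assumes "f \<in> P2 n"
  shows "(ess n f = 0 \<longrightarrow> imp n f = 1) \<and>
    (ess n f = 1 \<longrightarrow> imp n f = 2) \<and>
    (ess n f \<ge> 2 \<longrightarrow>
      imp n f = (\<Sum>i \<in> Ess n f. imp n (subst_const n f i False) + imp n (subst_const n f i True)))"
proof (intro conjI impI)
  assume "ess n f = 0"
  then show "imp n f = 1" using imp_ess_0[OF assms] finite_Ess by (simp add: ess_def)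
next
  assume "ess n f = 1"
  then obtain i where i: "Ess n f = {i}" by (auto simp: ess_def card_1_singleton_iff)
  \<comment> \<open>Substituting for the only essential variable leaves a constant, so the recursion
    gives \<open>1 + 1\<close>.\<close>
  then have "Ess n (subst_const n f i c) = {}" for c
    using Ess_subst_const[of i n f c] Ess_subset[of n f] by auto
  then have "imp n (subst_const n f i c) = 1" for c
    using imp_ess_0[OF subst_const_P2] by blast
  then show "imp n f = 2" using imp_rec[OF assms] i by simp
next
  assume "ess n f \<ge> 2"
  then have "Ess n f \<noteq> {}" by (auto simp: ess_def)
  then show "imp n f =
      (\<Sum>i \<in> Ess n f. imp n (subst_const n f i False) + imp n (subst_const n f i True))"
    by (rule imp_rec[OF assms])
qed

end
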